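(* Let $E$ be a finite dimensional Euclidean space with inner product $\langle\cdot,\cdot\rangle$ and norm $\|\cdot\|$, let $C$ be a finite dimensional complete normed space with norm $\|\cdot\|_C$, and let $J:E\times C\to\mathbb{R}$, viewed as a family of action functionals $x\mapsto J(x,u)$ on $E$ with parameter $u\in C$. Assume that there exist constants $\mu,a,\beta>0$ and $b\in\mathbb{R}$ such that $$J(x,u)\ge a\|x\|^{\mu}+b\quad\text{for all }x\in E\text{ with }\|x\|\ge\beta\text{ and all }u\in C.$$ Assume also that for every $u\in C$ the functional $x\mapsto J(x,u)$ is continuous and Gâteaux differentiable on $E$. Then for any $u\in C$ there exists at least one solution $x_u\in E$ to the problem $$\frac{d}{dx}J(x,u)=0.\qquad(\ast)$$ Assume further that there exists a constant $\alpha>0$ such that $J(0,u)\le\alpha$ for all $u\in C$. Let $\{u_n\}_{n=1}^\infty\subset C$ be a convergent sequence of parameters with $\lim_{n\to\infty}u_n=\overline{u}\in C$, and assume that either $J$ is continuous on $E\times C$, or the Gâteaux derivative $\frac{d}{dx}J(x,u)$ of $J$ with respect to $x$ is bounded on bounded sets in $E\times C$ and $J$ is continuous with respect to $u$ on $C$ for any $x\in E$. Then for any sequence $\{x_n\}_{n=1}^\infty$ of solutions $x_n\in E$ to the problem $(\ast)$ corresponding to $u=u_n$, $n=1,2,\dots$, there exist a subsequence $\{x_{n_i}\}_{i=1}^\infty\subset E$ and an element $\overline{x}\in E$ such that $\lim_{i\to\infty}x_{n_i}=\overline{x}$ and $$J(\overline{x},\overline{u})=\inf_{y\in E}J(y,\overline{u}).$$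 Moreover, $\overline{x}$ satisfies $(\ast)$ with $u=\overline{u}$, i.e. $\frac{d}{dx}J(\overline{x},\overline{u})=0$.
   Context: $\frac{d}{dx}J(x,u)$ denotes the Gâteaux derivative of $x\mapsto J(x,u)$ at $x$ (for fixed $u$).
   Formalization: The solutions x_n are additionally assumed to minimize J(·,u_n) over E; for arbitrary solutions of (∗) the claim fails, e.g. J(x,u)=(x²−1)² on the real line with x_n=0, where the limit 0 has J=1 but the infimum is 0. *)

theory Defs
  imports "HOL-Analysis.Analysis"
begin

(* The Gateaux derivative is an element of the dual space: the directional derivatives of f at x
   exist in all directions and depend on the direction linearly and continuously. *)
definition has_gateaux_derivative ::
    "('a::real_normed_vector \<Rightarrow> 'b::real_normed_vector) \<Rightarrow> ('a \<Rightarrow>\<^sub>L 'b) \<Rightarrow> 'a \<Rightarrow> bool" where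
  "has_gateaux_derivative f D x \<longleftrightarrow>
     (\<forall>v. ((\<lambda>t. (f (x + t *\<^sub>R v) - f x) /\<^sub>R t) \<longlongrightarrow> blinfun_apply D v) (at 0))"

definition gateaux_differentiable ::
    "('a::real_normed_vector \<Rightarrow> 'b::real_normed_vector) \<Rightarrow> 'a \<Rightarrow> bool" where
  "gateaux_differentiable f x \<longleftrightarrow> (\<exists>D. has_gateaux_derivative f D x)"

(* Unspecified where f is not Gateaux differentiable. *)
definition gateaux_deriv ::
    "('a::real_normed_vector \<Rightarrow> 'b::real_normed_vector) \<Rightarrow> 'a \<Rightarrow> 'a \<Rightarrow>\<^sub>L 'b" where
  "gateaux_deriv f x = (THE D. has_gateaux_derivative f D x)"

lemma has_gateaux_derivative_unique:
  assumes "has_gateaux_derivative f D x" and "has_gateaux_derivative f D' x"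
  shows "D = D'"
  using assms unfolding has_gateaux_derivative_def
  by (intro blinfun_eqI) (blast intro: tendsto_unique[OF trivial_limit_at])

lemma gateaux_deriv_eq:
  assumes "has_gateaux_derivative f D x"
  shows "gateaux_deriv f x = D"
  unfolding gateaux_deriv_def using assms by (blast intro: has_gateaux_derivative_unique)

lemma has_gateaux_derivative_gateaux_deriv:
  assumes "gateaux_differentiable f x"
  shows "has_gateaux_derivative f (gateaux_deriv f x) x"
  using assms gateaux_deriv_eq unfolding gateaux_differentiable_def by blast

(* A solution in this sense need not minimize J(.,u), and a limit of solutions need not either:
   for J(x,u) = (x^2 - 1)^2 on the real line, x = 0 is a solution for every u, but the infimum 0
   is attained only at 1 and -1.  Stability of solutions with a minimizing limit therefore
   concerns solutions that minimize, and minimality has to be assumed separately. *)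
definition solves ::
    "('a::real_normed_vector \<times> 'c \<Rightarrow> real) \<Rightarrow> 'c \<Rightarrow> 'a \<Rightarrow> bool" where
  "solves J u x \<longleftrightarrow> gateaux_deriv (\<lambda>y. J (y, u)) x = 0"

end

theory Submission
  imports Defs
begin

text \<open>Coercivity, uniform in the parameter, confines every sublevel set of \<open>J (_, u)\<close> to one ball
  that does not depend on \<open>u\<close>. Hence minimizers exist, and they solve the problem. Minimizers
  \<open>x n\<close> for \<open>u n\<close> satisfy \<open>J (x n, u n) \<le> J (0, u n) \<le> \<alpha>\<close>, so they stay in a compact ball and
  subconverge; passing to the limit in \<open>J (x n, u n) \<le> J (y, u n)\<close> shows that the limit
  minimizes. If \<open>J\<close> is only separately continuous, bounded derivatives make \<open>J (_, u n)\<close>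
  uniformly Lipschitz on bounded sets, which replaces joint continuity in that limit.\<close>

text \<open>At a minimum the difference quotients for \<open>t > 0\<close> are nonnegative, so
  \<open>D v\<close> is nonnegative in every direction. Linearity applied to \<open>- v\<close>
  turns this into equality.\<close>

lemma gateaux_derivative_eq_0_at_min:
  fixes f :: "'a::real_normed_vector \<Rightarrow> real"
  assumes D: "has_gateaux_derivative f D x" and min: "\<And>y. f x \<le> f y"
  shows "D = 0"
proof -
  have nonneg: "0 \<le> blinfun_apply D v" for v
  proof -
    have "((\<lambda>t. (f (x + t *\<^sub>R v) - f x) /\<^sub>R t) \<longlongrightarrow> blinfun_apply D v) (at_right 0)"
      using D unfolding has_gateaux_derivative_def by (meson filterlim_at_split)
    moreover have "\<forall>\<^sub>F t in at_right 0. 0 \<le> (f (x + t *\<^sub>R v) - f x) /\<^sub>R t"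
      using eventually_at_right_less[of "0::real"] by eventually_elim (simp add: min)
    ultimately show ?thesis
      by (rule tendsto_lowerbound) simp
  qed
  show ?thesis
  proof (rule blinfun_eqI)
    fix v
    show "blinfun_apply D v = blinfun_apply 0 v"
      using nonneg[of v] nonneg[of "- v"] by (simp add: blinfun.minus_right)
  qed
qed

lemma has_gateaux_derivative_imp_DERIV_line:
  fixes f :: "'a::real_normed_vector \<Rightarrow> real"
  assumes "has_gateaux_derivative f D (x + t *\<^sub>R v)"
  shows "((\<lambda>s. f (x + s *\<^sub>R v)) has_real_derivative blinfun_apply D v) (at t)"
proof -
  have "((\<lambda>h. (f (x + t *\<^sub>R v + h *\<^sub>R v) - f (x + t *\<^sub>R v)) /\<^sub>R h) \<longlongrightarrow> blinfun_apply D v) (at 0)"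
    using assms by (simp add: has_gateaux_derivative_def)
  then show ?thesis
    by (simp add: DERIV_def divide_inverse_commute scaleR_add_left add.assoc)
qed

text \<open>On the segment from \<open>x\<close> to \<open>y\<close>, which convexity keeps inside
  \<open>S\<close>, the function depends on one real variable, so the classical mean value theorem
  applies.\<close>

lemma gateaux_mean_value_bound:
  fixes f :: "'a::real_normed_vector \<Rightarrow> real"
  assumes "convex S" "x \<in> S" "y \<in> S"
    and D: "\<And>z. z \<in> S \<Longrightarrow> has_gateaux_derivative f (D z) z"
    and bound: "\<And>z. z \<in> S \<Longrightarrow> norm (D z) \<le> M"
  shows "\<bar>f y - f x\<bar> \<le> M * norm (y - x)"
proof -
  have inS: "x + t *\<^sub>R (y - x) \<in> S" if "0 \<le> t" "t \<le> 1" for t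
    using convexD_alt[OF assms(1-3) that] by (simp add: algebra_simps)
  have "\<exists>t>0. t < 1 \<and> f (x + 1 *\<^sub>R (y - x)) - f (x + 0 *\<^sub>R (y - x))
      = (1 - 0) * blinfun_apply (D (x + t *\<^sub>R (y - x))) (y - x)"
    by (rule MVT2) (auto intro!: has_gateaux_derivative_imp_DERIV_line D inS)
  then obtain t where t: "0 < t" "t < 1"
    and eq: "f y - f x = blinfun_apply (D (x + t *\<^sub>R (y - x))) (y - x)"
    by auto
  have "\<bar>f y - f x\<bar> \<le> norm (D (x + t *\<^sub>R (y - x))) * norm (y - x)"
    unfolding eq real_norm_def[symmetric] by (rule norm_blinfun)
  also have "\<dots> \<le> M * norm (y - x)"
    using t by (intro mult_right_mono bound inS) auto
  finally show ?thesis .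
qed

text \<open>The radius is fixed before \<open>f\<close>, so one \<open>R\<close> serves the whole
  family \<open>J (_, u)\<close>.\<close>

lemma powr_coercive_sublevel_bounded:
  fixes \<mu> a \<beta> b K :: real
  assumes "\<mu> > 0" "a > 0"
  obtains R where "\<And>f x. (\<And>y::'a::real_normed_vector. norm y \<ge> \<beta> \<Longrightarrow> f y \<ge> a * norm y powr \<mu> + b)
    \<Longrightarrow> f x \<le> K \<Longrightarrow> norm x \<le> R"
proof -
  \<comment> \<open>The second entry solves \<open>a * r powr \<mu> + b = K\<close> for
    \<open>r\<close> when \<open>K \<ge> b\<close>; the first covers the points where coercivity
    says nothing.\<close>
  define R where "R = max \<beta> (((K - b) / a) powr (1 / \<mu>))"
  show ?thesis
  proof (rule that[of R])
    fix f and x :: 'a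
    assume coercive: "\<And>y. norm y \<ge> \<beta> \<Longrightarrow> f y \<ge> a * norm y powr \<mu> + b" and "f x \<le> K"
    show "norm x \<le> R"
    proof (cases "norm x \<ge> \<beta>")
      case True
      have "norm x powr \<mu> \<le> (K - b) / a"
        using coercive[OF True] \<open>f x \<le> K\<close> \<open>a > 0\<close> by (simp add: field_simps)
      then have "(norm x powr \<mu>) powr (1 / \<mu>) \<le> ((K - b) / a) powr (1 / \<mu>)"
        using \<open>\<mu> > 0\<close> by (intro powr_mono2) auto
      then show ?thesis
        using \<open>\<mu> > 0\<close> by (simp add: powr_powr R_def)
    qed (simp add: R_def)
  qed
qed

text \<open>The sublevel set at height \<open>f c\<close> is compact and contains \<open>c\<close>.
  A minimizer on it is global, because every point outside has a value above
  \<open>f c\<close>.\<close>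

lemma continuous_attains_min_of_bounded_sublevel:
  fixes f :: "'a::heine_borel \<Rightarrow> real"
  assumes cont: "continuous_on UNIV f" and bounded: "bounded {x. f x \<le> f c}"
  obtains x where "\<And>y. f x \<le> f y"
proof -
  have "closed {x. f x \<le> f c}"
    using cont by (intro closed_Collect_le continuous_on_const)
  then have "compact {x. f x \<le> f c}"
    using bounded by (simp add: compact_eq_bounded_closed)
  then obtain x where "f x \<le> f c" and "\<And>y. f y \<le> f c \<Longrightarrow> f x \<le> f y"
    using continuous_attains_inf[of "{x. f x \<le> f c}" f] continuous_on_subset[OF cont] by blast
  then show ?thesis
    by (meson that le_cases order_trans)
qed

text \<open>An attained minimum rules out the unspecified \<open>INF\<close> of a set unbounded
  below, so conditions on the infimum can be traded for pointwise inequalities.\<close>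

lemma eq_INF_iff_attained:
  fixes f :: "'a \<Rightarrow> 'b::conditionally_complete_linorder"
  assumes "\<And>y. f m \<le> f y"
  shows "f x = (INF y. f y) \<longleftrightarrow> (\<forall>y. f x \<le> f y)"
proof -
  have "(INF y. f y) = f m"
    by (rule cInf_eq_minimum) (use assms in auto)
  then show ?thesis
    by (metis assms order_antisym)
qed

theorem theorem7:
  fixes J :: "'a::euclidean_space \<times> 'c::banach \<Rightarrow> real"
    and \<mu> a \<beta> b :: real
  assumes finite_dim: "\<exists>B::'c set. finite B \<and> span B = UNIV"
    and pos: "\<mu> > 0" "a > 0" "\<beta> > 0"
    and coercive: "\<forall>x u. norm x \<ge> \<beta> \<longrightarrow> J (x, u) \<ge> a * norm x powr \<mu> + b"
    and cont: "\<forall>u. continuous_on UNIV (\<lambda>x. J (x, u))"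
    and diff: "\<forall>u x. gateaux_differentiable (\<lambda>y. J (y, u)) x"
  shows "(\<forall>u. \<exists>x. solves J u x) \<and>
    (\<forall>\<alpha> (u :: nat \<Rightarrow> 'c) ubar (x :: nat \<Rightarrow> 'a).
        \<alpha> > 0 \<and> (\<forall>v. J (0, v) \<le> \<alpha>) \<and>
        u \<longlonglongrightarrow> ubar \<and>
        (continuous_on UNIV J \<or>
          (\<forall>S. bounded S \<longrightarrow> bounded ((\<lambda>(y, v). gateaux_deriv (\<lambda>z. J (z, v)) y) ` S)) \<and>
          (\<forall>y. continuous_on UNIV (\<lambda>v. J (y, v)))) \<and>
        (\<forall>n. solves J (u n) (x n) \<and> J (x n, u n) = (INF y. J (y, u n)))
      \<longrightarrow> (\<exists>r xbar. strict_mono (r :: nat \<Rightarrow> nat) \<and> (x \<circ> r) \<longlonglongrightarrow> xbar \<and>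
              J (xbar, ubar) = (INF y. J (y, ubar)) \<and>
              solves J ubar xbar))"
proof -
  have exists_min: "\<exists>m. \<forall>y. J (m, v) \<le> J (y, v)" for v
  proof -
    obtain R where R: "\<And>f x. (\<And>y::'a. norm y \<ge> \<beta> \<Longrightarrow> f y \<ge> a * norm y powr \<mu> + b)
        \<Longrightarrow> f x \<le> J (0, v) \<Longrightarrow> norm x \<le> R"
      using powr_coercive_sublevel_bounded[OF pos(1,2), of \<beta> b "J (0, v)"] by blast
    have "bounded {x. J (x, v) \<le> J (0, v)}"
      using R[of "\<lambda>x. J (x, v)"] coercive by (auto simp: bounded_iff)
    then show ?thesis
      using continuous_attains_min_of_bounded_sublevel[of "\<lambda>x. J (x, v)" 0] cont by metis
  qed
  have eq_INF: "J (x, v) = (INF y. J (y, v)) \<longleftrightarrow> (\<forall>y. J (x, v) \<le> J (y, v))" for x v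
    using exists_min[of v] eq_INF_iff_attained[of "\<lambda>x. J (x, v)"] by blast
  have deriv: "has_gateaux_derivative (\<lambda>y. J (y, v)) (gateaux_deriv (\<lambda>y. J (y, v)) x) x" for v x
    using diff by (blast intro: has_gateaux_derivative_gateaux_deriv)
  have solves_min: "solves J v x" if "\<forall>y. J (x, v) \<le> J (y, v)" for v x
    unfolding solves_def using gateaux_derivative_eq_0_at_min[OF deriv] that by blast
  have stable: "\<exists>r xbar. strict_mono (r :: nat \<Rightarrow> nat) \<and> (x \<circ> r) \<longlonglongrightarrow> xbar \<and>
      J (xbar, ubar) = (INF y. J (y, ubar)) \<and> solves J ubar xbar"
    if \<alpha>: "\<forall>v. J (0, v) \<le> \<alpha>" and u: "u \<longlonglongrightarrow> ubar"
      and reg: "continuous_on UNIV J \<or>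
          (\<forall>S. bounded S \<longrightarrow> bounded ((\<lambda>(y, v). gateaux_deriv (\<lambda>z. J (z, v)) y) ` S)) \<and>
          (\<forall>y. continuous_on UNIV (\<lambda>v. J (y, v)))"
      and x: "\<forall>n. J (x n, u n) = (INF y. J (y, u n))"
    for \<alpha> u ubar and x :: "nat \<Rightarrow> 'a"
  proof -
    have x_min: "J (x n, u n) \<le> J (y, u n)" for n y
      using x eq_INF by blast
    \<comment> \<open>The level \<open>\<alpha>\<close> bounds \<open>J (0, u n)\<close> for all
      \<open>n\<close> at once, so this radius does not depend on \<open>n\<close>.\<close>
    obtain R where R: "\<And>f x. (\<And>y::'a. norm y \<ge> \<beta> \<Longrightarrow> f y \<ge> a * norm y powr \<mu> + b)
        \<Longrightarrow> f x \<le> \<alpha> \<Longrightarrow> norm x \<le> R"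
      using powr_coercive_sublevel_bounded[OF pos(1,2), of \<beta> b \<alpha>] by blast
    have x_R: "x n \<in> cball 0 R" for n
    proof -
      have "J (x n, u n) \<le> \<alpha>"
        using x_min[of n 0] \<alpha> by (blast intro: order_trans)
      then have "norm (x n) \<le> R"
        using R[of "\<lambda>y. J (y, u n)" "x n"] coercive by blast
      then show ?thesis by simp
    qed
    obtain xbar r where xbar_R: "xbar \<in> cball 0 R" and r: "strict_mono r" and xr: "(x \<circ> r) \<longlonglongrightarrow> xbar"
      using seq_compactE[of "cball (0::'a) R" x] x_R by (metis compact_cball compact_imp_seq_compact)
    have ur: "(u \<circ> r) \<longlonglongrightarrow> ubar"
      using LIMSEQ_subseq_LIMSEQ[OF u r] .
    have J_snd: "(\<lambda>n. J (y, u (r n))) \<longlonglongrightarrow> J (y, ubar)" for y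
    proof -
      have "continuous_on UNIV (\<lambda>v. J (y, v))"
        using reg
      proof
        assume "continuous_on UNIV J"
        then show ?thesis
          by (rule continuous_on_compose2) (auto intro: continuous_on_Pair continuous_on_const continuous_on_id)
      qed simp
      from continuous_on_tendsto_compose[OF this ur] show ?thesis
        by (simp add: o_def)
    qed
    have J_lim: "(\<lambda>n. J (x (r n), u (r n))) \<longlonglongrightarrow> J (xbar, ubar)"
      using reg
    proof
      assume "continuous_on UNIV J"
      from continuous_on_tendsto_compose[OF this tendsto_Pair[OF xr ur]] show ?thesis
        by (simp add: o_def)
    next
      assume bdd: "(\<forall>S. bounded S \<longrightarrow> bounded ((\<lambda>(y, v). gateaux_deriv (\<lambda>z. J (z, v)) y) ` S)) \<and>
          (\<forall>y. continuous_on UNIV (\<lambda>v. J (y, v)))"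
      \<comment> \<open>A convergent sequence has bounded range, so a single \<open>M\<close> bounds
        the derivatives for all parameters \<open>u n\<close>.\<close>
      have "bounded (cball (0::'a) R \<times> range u)"
        using convergent_imp_bounded[OF u] by (intro bounded_Times) auto
      then have "bounded ((\<lambda>(y, v). gateaux_deriv (\<lambda>z. J (z, v)) y) ` (cball 0 R \<times> range u))"
        using bdd by blast
      then obtain M where
        "\<forall>D \<in> (\<lambda>(y, v). gateaux_deriv (\<lambda>z. J (z, v)) y) ` (cball 0 R \<times> range u). norm D \<le> M"
        unfolding bounded_iff by blast
      then have M: "norm (gateaux_deriv (\<lambda>z. J (z, u n)) y) \<le> M" if "y \<in> cball 0 R" for y n
        using that by force
      \<comment> \<open>The two arguments are moved one at a time: from \<open>x (r n)\<close> to
        \<open>xbar\<close> by this Lipschitz estimate, uniform in \<open>n\<close>, then from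
        \<open>u (r n)\<close> to \<open>ubar\<close> by \<open>J_snd\<close>.\<close>
      have lip: "\<bar>J (x (r n), u (r n)) - J (xbar, u (r n))\<bar> \<le> M * norm (x (r n) - xbar)" for n
        by (rule gateaux_mean_value_bound[OF convex_cball xbar_R x_R deriv M])
      have lim: "(\<lambda>n. M * norm (x (r n) - xbar)) \<longlonglongrightarrow> 0"
        using xr by (intro tendsto_mult_right_zero tendsto_norm_zero) (simp add: o_def LIM_zero)
      have "(\<lambda>n. J (x (r n), u (r n)) - J (xbar, u (r n))) \<longlonglongrightarrow> 0"
        by (rule Lim_null_comparison[OF _ lim]) (simp add: lip)
      from tendsto_add[OF this J_snd[of xbar]] show ?thesis by simp
    qed
    \<comment> \<open>Only values of \<open>J\<close> pass to the limit, never derivatives; that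
      \<open>xbar\<close> is a solution then follows from its minimality.\<close>
    have "J (xbar, ubar) \<le> J (y, ubar)" for y
      using LIMSEQ_le[OF J_lim J_snd] x_min by blast
    then show ?thesis
      using r xr eq_INF solves_min by blast
  qed
  show ?thesis
  proof (intro conjI allI impI)
    show "\<exists>x. solves J v x" for v
      using exists_min solves_min by blast
  qed (elim conjE, rule stable, assumption+, blast)
qed

end
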